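(* If $n\geq 1$, then $$\mathrm{tot}_n(12)=\frac{(n-1)(3^{n-1}+1)}{4},\qquad \mathrm{tot}_n(21)=\frac{(n-1)(3^{n-2}-1)}{4},\qquad \mathrm{tot}_n(11)=\frac{(n-1)(3^{n-2}+1)}{2}.$$ Moreover, the sum of the $\mathrm{trun}-1$ values of all the members of $\mathcal{F}_n$ is given by $\frac{3^{n-1}-1}{2}$ for $n\geq 1$; that is, $\sum_{\pi\in\mathcal{F}_n}(\mathrm{trun}(\pi)-1)=\frac{3^{n-1}-1}{2}$.
   Context: A Catalan word of length $n\geq 1$ is an integer sequence $\pi=\pi_1\cdots\pi_n$ with $\pi_1=1$ and $1\leq \pi_{i+1}\leq \pi_i+1$ for $1\leq i\leq n-1$. A (weakly) increasing run of a word is a maximal nondecreasing string of consecutive letters. A Catalan word is flattened if the sequence of first letters of its increasing runs, read from left to right, is nondecreasing. $\mathcal{F}_n$ is the set of flattened Catalan words of length $n$. For a word $w$, $\mathrm{trun}(w)$ is the number of distinct letters appearing in the rightmost increasing run of $w$. For a pattern $\tau=\tau_1\cdots\tau_m$, $\mathrm{tot}_n(\tau)$ is the total number of occurrences of $\tau$ as a consecutive (subword) pattern in all members of $\mathcal{F}_n$, i.e., the number of pairs $(\pi,i)$ with $\pi\in\mathcal{F}_n$ and $\pi_i\pi_{i+1}\cdots\pi_{i+m-1}$ order-isomorphic to $\tau$; thus $12$, $21$, $11$ count ascents, descents and levels, respectively. *)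

theory Defs
  imports Complex_Main "HOL-Library.Product_Lexorder"
begin

text \<open>Words are lists of integers. List positions are counted from 0, so the letter
  \<open>\<pi>\<^sub>i\<close> is \<^term>\<open>\<pi> ! (i - 1)\<close>.\<close>

definition catalan_word :: "int list \<Rightarrow> bool" where
  "catalan_word \<pi> \<longleftrightarrow> \<pi> \<noteq> [] \<and> \<pi> ! 0 = 1 \<and>
     (\<forall>i. i + 1 < length \<pi> \<longrightarrow> 1 \<le> \<pi> ! (i + 1) \<and> \<pi> ! (i + 1) \<le> \<pi> ! i + 1)"

text \<open>The string of consecutive letters at positions \<open>i, \<dots>, j - 1\<close>.\<close>

definition factor :: "nat \<Rightarrow> nat \<Rightarrow> int list \<Rightarrow> int list" where
  "factor i j w = drop i (take j w)"

definition nondecreasing_factor :: "int list \<Rightarrow> nat \<Rightarrow> nat \<Rightarrow> bool" where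
  "nondecreasing_factor w i j \<longleftrightarrow> i < j \<and> j \<le> length w \<and> sorted (factor i j w)"

definition increasing_run :: "int list \<Rightarrow> nat \<Rightarrow> nat \<Rightarrow> bool" where
  "increasing_run w i j \<longleftrightarrow> nondecreasing_factor w i j \<and>
     (\<forall>i' j'. nondecreasing_factor w i' j' \<and> i' \<le> i \<and> j \<le> j' \<longrightarrow> i' = i \<and> j' = j)"

text \<open>The runs, listed from left to right: pairs are ordered lexicographically, hence
  by starting position.\<close>

definition increasing_runs :: "int list \<Rightarrow> int list list" where
  "increasing_runs w =
     map (\<lambda>(i, j). factor i j w) (sorted_list_of_set {(i, j). increasing_run w i j})"

definition flattened :: "int list \<Rightarrow> bool" where
  "flattened w \<longleftrightarrow> sorted (map hd (increasing_runs w))"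

definition flattened_catalan_words :: "nat \<Rightarrow> int list set" where
  "flattened_catalan_words n = {\<pi>. length \<pi> = n \<and> catalan_word \<pi> \<and> flattened \<pi>}"

definition trun :: "int list \<Rightarrow> nat" where
  "trun w = card (set (last (increasing_runs w)))"

text \<open>Equality of letters is covered as well, being the absence of strict inequality
  in both directions.\<close>

definition order_isomorphic :: "int list \<Rightarrow> int list \<Rightarrow> bool" where
  "order_isomorphic u v \<longleftrightarrow> length u = length v \<and>
     (\<forall>a < length u. \<forall>b < length u. u ! a < u ! b \<longleftrightarrow> v ! a < v ! b)"

definition tot :: "nat \<Rightarrow> int list \<Rightarrow> nat" where
  "tot n \<tau> = card {(\<pi>, i). \<pi> \<in> flattened_catalan_words n \<and> i + length \<tau> \<le> n \<and>
     order_isomorphic (factor i (i + length \<tau>) \<pi>) \<tau>}"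

end

theory Submission
  imports Defs
begin

text \<open>
  Build the words letter by letter from the left. Let a flattened Catalan word have last
  letter \<open>l\<close>, and let \<open>f\<close> be the first letter of its last increasing run. Appending \<open>x\<close>
  keeps the word Catalan iff \<open>1 \<le> x \<le> l + 1\<close>. If \<open>x \<ge> l\<close>, the last run is prolonged and
  the word stays flattened; if \<open>x < l\<close>, a new run with first letter \<open>x\<close> starts, and the word
  stays flattened iff \<open>x \<ge> f\<close>. So the admissible letters are exactly \<open>f, \<dots>, l + 1\<close>
  (lemma \<open>flattened_catalan_words_Suc\<close>). With \<open>d = l - f\<close>, they give \<open>d\<close> descents, each
  leading to \<open>d = 0\<close>, one level, which preserves \<open>d\<close>, and one ascent, which raises \<open>d\<close> by one.
  Since a run of a Catalan word skips no letter, \<open>d\<close> is also \<open>trun - 1\<close> (lemma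
  \<open>trun_eq_rise\<close>). All this rests on \<open>increasing_runs_snoc\<close>, which says how an appended letter
  changes the list of runs.

  Let \<open>s\<close> be the statistic that charges \<open>\<alpha>\<close> for every ascent, \<open>\<beta>\<close> for every level and \<open>\<gamma>\<close>
  for every descent. The transition rule turns into linear recurrences in the length for
  \<open>A = \<Sum> 1\<close>, \<open>T = \<Sum> d\<close>, \<open>X = \<Sum> s\<close> and \<open>Y = \<Sum> s d\<close>:
  \<open>A' = 2 A + T\<close>, \<open>T' = A + 2 T\<close>,
  \<open>X' = 2 X + Y + (\<alpha> + \<beta>) A + \<gamma> T\<close>, \<open>Y' = X + 2 Y + \<alpha> (A + T) + \<beta> T\<close>.
  Passing to sums and differences decouples them: \<open>A + T\<close> triples and \<open>A - T\<close> is constant,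
  while \<open>X + Y\<close> and \<open>X - Y\<close> obey first-order recurrences with known inhomogeneous terms.
  The three pattern counts are the values of \<open>X\<close> at the unit weights, and the last
  claim is the value of \<open>T\<close>.
\<close>

section \<open>Increasing runs and appended letters\<close>

lemma nondecreasing_factor_iff_steps:
  "nondecreasing_factor w i j \<longleftrightarrow>
     i < j \<and> j \<le> length w \<and> (\<forall>k. i \<le> k \<and> k + 1 < j \<longrightarrow> w ! k \<le> w ! (k + 1))"
proof -
  have "sorted (factor i j w) \<longleftrightarrow> (\<forall>k. i \<le> k \<and> k + 1 < j \<longrightarrow> w ! k \<le> w ! (k + 1))"
    if "i < j" "j \<le> length w"
  proof -
    have "sorted (factor i j w) \<longleftrightarrow> (\<forall>k. k + 1 < j - i \<longrightarrow> w ! (i + k) \<le> w ! (i + k + 1))"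
      using that by (auto simp: sorted_iff_nth_Suc factor_def)
    also have "\<dots> \<longleftrightarrow> (\<forall>k. i \<le> k \<and> k + 1 < j \<longrightarrow> w ! k \<le> w ! (k + 1))"
    proof safe
      fix k assume a: "\<forall>k. k + 1 < j - i \<longrightarrow> w ! (i + k) \<le> w ! (i + k + 1)" "i \<le> k" "k + 1 < j"
      then have "k - i + 1 < j - i" by auto
      with a have "w ! (i + (k - i)) \<le> w ! (i + (k - i) + 1)" by blast
      then show "w ! k \<le> w ! (k + 1)" using a by auto
    next
      fix k assume a: "\<forall>k. i \<le> k \<and> k + 1 < j \<longrightarrow> w ! k \<le> w ! (k + 1)" "k + 1 < j - i"
      then have "i \<le> i + k \<and> i + k + 1 < j" by auto
      with a show "w ! (i + k) \<le> w ! (i + k + 1)" by blast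
    qed
    finally show ?thesis .
  qed
  then show ?thesis by (auto simp: nondecreasing_factor_def)
qed

text \<open>
  Maximality only has to be tested at the two neighbouring letters, because an extension of
  a nondecreasing factor contains an extension by one letter. This form is local, so that
  it can be compared between a word and its prolongation.
\<close>

lemma increasing_run_iff_neighbours:
  "increasing_run w i j \<longleftrightarrow> nondecreasing_factor w i j \<and>
     (i = 0 \<or> w ! i < w ! (i - 1)) \<and> (j = length w \<or> w ! j < w ! (j - 1))"
proof (cases "nondecreasing_factor w i j")
  case True
  then have ij: "i < j" "j \<le> length w"
    and steps: "\<And>k. i \<le> k \<Longrightarrow> k + 1 < j \<Longrightarrow> w ! k \<le> w ! (k + 1)"
    by (auto simp: nondecreasing_factor_iff_steps)
  show ?thesis
  proof
    assume run: "increasing_run w i j"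
    have "w ! i < w ! (i - 1)" if "i \<noteq> 0"
    proof (rule ccontr)
      assume le: "\<not> w ! i < w ! (i - 1)"
      have "nondecreasing_factor w (i - 1) j"
        unfolding nondecreasing_factor_iff_steps
      proof (intro conjI allI impI)
        fix k assume k: "i - 1 \<le> k \<and> k + 1 < j"
        show "w ! k \<le> w ! (k + 1)"
          by (cases "k = i - 1") (use k le that steps in auto)
      qed (use ij in auto)
      then have "i - 1 = i" using run unfolding increasing_run_def by (metis diff_le_self order_refl)
      with that show False by simp
    qed
    moreover have "w ! j < w ! (j - 1)" if "j \<noteq> length w"
    proof (rule ccontr)
      assume le: "\<not> w ! j < w ! (j - 1)"
      have "nondecreasing_factor w i (j + 1)"
        unfolding nondecreasing_factor_iff_steps
      proof (intro conjI allI impI)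
        fix k assume k: "i \<le> k \<and> k + 1 < j + 1"
        show "w ! k \<le> w ! (k + 1)"
          by (cases "k = j - 1") (use k le ij steps in auto)
      qed (use ij that in auto)
      then have "j + 1 = j" using run unfolding increasing_run_def by (metis le_add1 order_refl)
      then show False by simp
    qed
    ultimately show "nondecreasing_factor w i j \<and>
        (i = 0 \<or> w ! i < w ! (i - 1)) \<and> (j = length w \<or> w ! j < w ! (j - 1))"
      using True by blast
  next
    assume ends: "nondecreasing_factor w i j \<and>
        (i = 0 \<or> w ! i < w ! (i - 1)) \<and> (j = length w \<or> w ! j < w ! (j - 1))"
    show "increasing_run w i j"
      unfolding increasing_run_def
    proof (intro conjI allI impI True)
      fix i' j' assume a: "nondecreasing_factor w i' j' \<and> i' \<le> i \<and> j \<le> j'"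
      then have steps': "\<And>k. i' \<le> k \<Longrightarrow> k + 1 < j' \<Longrightarrow> w ! k \<le> w ! (k + 1)" and "j' \<le> length w"
        by (auto simp: nondecreasing_factor_iff_steps)
      show "i' = i"
      proof (rule ccontr)
        assume "i' \<noteq> i"
        with a ij have "i' \<le> i - 1" "i - 1 + 1 = i" "i < j'" "i \<noteq> 0" by auto
        with steps'[of "i - 1"] ends show False by auto
      qed
      show "j' = j"
      proof (rule ccontr)
        assume "j' \<noteq> j"
        with a ij have "i' \<le> j - 1" "j - 1 + 1 = j" "j < j'" by auto
        with steps'[of "j - 1"] ends \<open>j' \<le> length w\<close> show False by auto
      qed
    qed
  qed
qed (auto simp: increasing_run_def)

lemma increasing_run_bounds: "increasing_run w i j \<Longrightarrow> i < j \<and> j \<le> length w"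
  by (simp add: increasing_run_def nondecreasing_factor_def)

lemma finite_increasing_runs: "finite {(i, j). increasing_run w i j}"
  by (rule finite_subset[of _ "{..length w} \<times> {..length w}"])
     (auto dest: increasing_run_bounds)

lemma increasing_run_unique_start:
  assumes "increasing_run w i j" "increasing_run w i' j"
  shows "i' = i"
proof (cases "i \<le> i'")
  case True
  with assms show ?thesis unfolding increasing_run_def by blast
next
  case False
  then have "i' \<le> i" by simp
  with assms show ?thesis unfolding increasing_run_def by blast
qed

lemma increasing_run_snoc_descent:
  assumes "w \<noteq> []" "x < last w"
  shows "increasing_run (w @ [x]) i j \<longleftrightarrow>
           increasing_run w i j \<or> (i = length w \<and> j = length w + 1)"
proof -
  have lt: "x < w ! (length w - 1)" "0 < length w" using assms by (auto simp: last_conv_nth)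
  show ?thesis
  proof (cases "i < length w \<and> j = length w + 1")
    case True
    have "(w @ [x]) ! (length w - 1 + 1) < (w @ [x]) ! (length w - 1)"
      using lt by (simp add: nth_append)
    moreover have "i \<le> length w - 1 \<and> length w - 1 + 1 < j" using True lt by auto
    ultimately have "\<not> nondecreasing_factor (w @ [x]) i j"
      unfolding nondecreasing_factor_iff_steps by (meson not_le)
    then have "\<not> increasing_run (w @ [x]) i j" by (simp add: increasing_run_def)
    moreover have "\<not> increasing_run w i j" using True by (auto dest: increasing_run_bounds)
    ultimately show ?thesis using True by auto
  next
    case False
    with lt show ?thesis
      unfolding increasing_run_iff_neighbours nondecreasing_factor_iff_steps
      by (cases "j \<le> length w"; cases "i < length w") (auto simp: nth_append le_Suc_eq not_le)
  qed
qed

text \<open>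
  Since \<open>last w\<close> and \<open>x\<close> form a nondecreasing pair, no maximal nondecreasing factor begins or
  ends between them: the run that ended with \<open>last w\<close> now takes in \<open>x\<close>, and the other runs
  are out of reach of the new letter.
\<close>

lemma increasing_run_snoc_weak_ascent:
  assumes "w \<noteq> []" "last w \<le> x"
  shows "increasing_run (w @ [x]) i j \<longleftrightarrow>
           (increasing_run w i j \<and> j < length w) \<or> (increasing_run w i (length w) \<and> j = length w + 1)"
proof -
  have le: "w ! (length w - 1) \<le> x" "0 < length w" using assms by (auto simp: last_conv_nth)
  consider "j < length w" | "j = length w" | "j = length w + 1" | "j > length w + 1" by linarith
  then show ?thesis
  proof cases
    case 3
    have "(\<forall>k. i \<le> k \<and> k + 1 < j \<longrightarrow> (w @ [x]) ! k \<le> (w @ [x]) ! (k + 1)) \<longleftrightarrow>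
          (\<forall>k. i \<le> k \<and> k + 1 < length w \<longrightarrow> w ! k \<le> w ! (k + 1))"
    proof (intro iffI allI impI)
      fix k assume a: "\<forall>k. i \<le> k \<and> k + 1 < j \<longrightarrow> (w @ [x]) ! k \<le> (w @ [x]) ! (k + 1)"
        and k: "i \<le> k \<and> k + 1 < length w"
      show "w ! k \<le> w ! (k + 1)" using spec[OF a, of k] k 3 by (auto simp: nth_append)
    next
      fix k assume a: "\<forall>k. i \<le> k \<and> k + 1 < length w \<longrightarrow> w ! k \<le> w ! (k + 1)"
        and k: "i \<le> k \<and> k + 1 < j"
      show "(w @ [x]) ! k \<le> (w @ [x]) ! (k + 1)"
        by (cases "k = length w - 1") (use spec[OF a, of k] k 3 le in \<open>auto simp: nth_append\<close>)
    qed
    with 3 le show ?thesis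
      unfolding increasing_run_iff_neighbours nondecreasing_factor_iff_steps
      by (cases "i = length w") (auto simp: nth_append)
  qed (use le in \<open>auto simp: increasing_run_iff_neighbours nondecreasing_factor_iff_steps nth_append\<close>)
qed

lemma sorted_list_of_set_insert_greatest:
  assumes "finite S" "\<And>y. y \<in> S \<Longrightarrow> y < m"
  shows "sorted_list_of_set (insert m S) = sorted_list_of_set S @ [m]"
proof (rule sorted_distinct_set_unique)
  show "sorted (sorted_list_of_set S @ [m])" "distinct (sorted_list_of_set S @ [m])"
    using assms by (auto simp: sorted_append less_imp_le)
  show "set (sorted_list_of_set (insert m S)) = set (sorted_list_of_set S @ [m])"
    using assms by (subst set_sorted_list_of_set) auto
qed (simp_all del: sorted_list_of_set_insert_remove)

text \<open>
  The list of runs ends with the greatest pair of run bounds. That this pair reaches the end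
  of the word identifies the run which a further letter prolongs with the last one listed.
\<close>

lemma last_run_reaches_end:
  assumes "w \<noteq> []"
  shows "\<exists>i. increasing_run w i (length w) \<and>
           (\<forall>p \<in> {(i, j). increasing_run w i j} - {(i, length w)}. p < (i, length w))"
  using assms
proof (induction w rule: rev_nonempty_induct)
  case (single x)
  have "increasing_run [x] i j \<longleftrightarrow> i = 0 \<and> j = 1" for i j
    by (auto simp: increasing_run_iff_neighbours nondecreasing_factor_iff_steps)
  then show ?case by auto
next
  case (snoc x w)
  show ?case
  proof (cases "x < last w")
    case True
    then show ?thesis
      using increasing_run_snoc_descent[OF snoc.hyps True]
      by (intro exI[of _ "length w"]) (auto dest: increasing_run_bounds)
  next
    case False
    from snoc.IH obtain i where i: "increasing_run w i (length w)"
      and greatest: "\<And>i' j'. increasing_run w i' j' \<Longrightarrow> (i', j') \<noteq> (i, length w) \<Longrightarrow> (i', j') < (i, length w)"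
      by blast
    let ?n = "length w"
    have runs: "(i', j') = (i, ?n + 1) \<or> increasing_run w i' j' \<and> j' < ?n"
      if "increasing_run (w @ [x]) i' j'" for i' j'
      using that increasing_run_snoc_weak_ascent[of w x i' j'] increasing_run_unique_start[OF i]
        snoc.hyps False by auto
    have less: "(i', j') < (i, ?n + 1)" if "increasing_run w i' j'" "j' < ?n" for i' j'
    proof -
      have "(i', j') < (i, ?n)" using greatest[of i' j'] that by blast
      then show ?thesis by auto
    qed
    have "increasing_run (w @ [x]) i (?n + 1)"
      using increasing_run_snoc_weak_ascent[of w x] snoc.hyps False i by auto
    then have "increasing_run (w @ [x]) i (length (w @ [x]))" by simp
    moreover have "p < (i, length (w @ [x]))"
      if p: "p \<in> {(i, j). increasing_run (w @ [x]) i j} - {(i, length (w @ [x]))}" for p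
    proof -
      obtain i' j' where eq: "p = (i', j')" by (cases p)
      with p have "increasing_run (w @ [x]) i' j'" "(i', j') \<noteq> (i, ?n + 1)" by auto
      with runs less have "(i', j') < (i, ?n + 1)" by blast
      with eq show ?thesis by simp
    qed
    ultimately show ?thesis by blast
  qed
qed

lemma factor_append_left: "j \<le> length w \<Longrightarrow> factor i j (w @ v) = factor i j w"
  by (simp add: factor_def)

text \<open>
  A descent adds a pair of bounds beyond all others. Any other letter replaces the greatest
  pair \<open>(i, n)\<close>, where \<open>n\<close> is the length, by \<open>(i, n + 1)\<close>, which is again the greatest. So
  the sorted list changes at its end only.
\<close>

lemma increasing_runs_snoc:
  assumes "w \<noteq> []"
  shows "increasing_runs (w @ [x]) =
    (if x < last w then increasing_runs w @ [[x]]
     else butlast (increasing_runs w) @ [last (increasing_runs w) @ [x]])"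
proof -
  let ?R = "{(i, j). increasing_run w i j}" and ?n = "length w"
  obtain i where i: "increasing_run w i ?n"
    and greatest: "\<And>p. p \<in> ?R - {(i, ?n)} \<Longrightarrow> p < (i, ?n)"
    using last_run_reaches_end[OF assms] by blast
  show ?thesis
  proof (cases "x < last w")
    case True
    have "{(i, j). increasing_run (w @ [x]) i j} = insert (?n, ?n + 1) ?R"
      using increasing_run_snoc_descent[OF assms True] by auto
    moreover have "sorted_list_of_set (insert (?n, ?n + 1) ?R) = sorted_list_of_set ?R @ [(?n, ?n + 1)]"
      by (rule sorted_list_of_set_insert_greatest[OF finite_increasing_runs])
         (auto dest: increasing_run_bounds)
    moreover have "map (\<lambda>(i, j). factor i j (w @ [x])) (sorted_list_of_set ?R) = increasing_runs w"
      unfolding increasing_runs_def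
      by (rule map_cong)
         (auto simp: finite_increasing_runs factor_append_left dest: increasing_run_bounds)
    ultimately show ?thesis
      using True by (simp add: increasing_runs_def factor_def)
  next
    case False
    let ?S = "?R - {(i, ?n)}"
    have fin: "finite ?S" using finite_increasing_runs by simp
    have unique: "increasing_run w i' ?n \<longleftrightarrow> i' = i" for i'
      using i increasing_run_unique_start by blast
    have bounds: "{(i, j). increasing_run (w @ [x]) i j} = insert (i, ?n + 1) ?S"
    proof (intro set_eqI, clarify)
      fix i' j
      have "increasing_run w i' j \<and> j < ?n \<longleftrightarrow> (i', j) \<in> ?S"
        using unique[of i'] increasing_run_bounds[of w i' j] by (cases "j = ?n") auto
      then show "(i', j) \<in> {(i, j). increasing_run (w @ [x]) i j} \<longleftrightarrow> (i', j) \<in> insert (i, ?n + 1) ?S"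
        using increasing_run_snoc_weak_ascent[of w x i' j] unique[of i'] assms False by auto
    qed
    have "sorted_list_of_set (insert (i, ?n + 1) ?S) = sorted_list_of_set ?S @ [(i, ?n + 1)]"
      by (rule sorted_list_of_set_insert_greatest[OF fin], drule greatest) auto
    moreover have "sorted_list_of_set (insert (i, ?n) ?S) = sorted_list_of_set ?S @ [(i, ?n)]"
      by (rule sorted_list_of_set_insert_greatest[OF fin greatest])
    moreover have "insert (i, ?n) ?S = ?R" using i by auto
    moreover have "map (\<lambda>(i, j). factor i j (w @ [x])) (sorted_list_of_set ?S) =
                   map (\<lambda>(i, j). factor i j w) (sorted_list_of_set ?S)"
    proof (rule map_cong[OF refl])
      fix p assume "p \<in> set (sorted_list_of_set ?S)"
      then have "p \<in> ?S" by (simp only: set_sorted_list_of_set[OF fin])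
      then show "(case p of (i, j) \<Rightarrow> factor i j (w @ [x])) = (case p of (i, j) \<Rightarrow> factor i j w)"
        by (auto simp: factor_append_left dest: increasing_run_bounds)
    qed
    moreover have "factor i (?n + 1) (w @ [x]) = factor i ?n w @ [x]"
      using increasing_run_bounds[OF i] by (simp add: factor_def)
    ultimately show ?thesis
      using False bounds by (simp add: increasing_runs_def)
  qed
qed

lemma increasing_runs_singleton: "increasing_runs [x] = [[x]]"
proof -
  have "{(i, j). increasing_run [x] i j} = {(0, 1)}"
    by (auto simp: increasing_run_iff_neighbours nondecreasing_factor_iff_steps)
  then show ?thesis by (simp add: increasing_runs_def factor_def)
qed

lemma increasing_runs_nonempty:
  assumes "w \<noteq> []"
  shows "increasing_runs w \<noteq> [] \<and> last (increasing_runs w) \<noteq> []"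
  using assms
  by (induction w rule: rev_nonempty_induct) (auto simp: increasing_runs_singleton increasing_runs_snoc)

section \<open>The transition rule\<close>

definition last_run_head :: "int list \<Rightarrow> int" where
  "last_run_head w = hd (last (increasing_runs w))"

definition last_run_rise :: "int list \<Rightarrow> int" where
  "last_run_rise w = last w - last_run_head w"

lemma last_run_head_singleton: "last_run_head [x] = x"
  by (simp add: last_run_head_def increasing_runs_singleton)

lemma last_run_head_snoc:
  "w \<noteq> [] \<Longrightarrow> last_run_head (w @ [x]) = (if x < last w then x else last_run_head w)"
  using increasing_runs_nonempty[of w] by (simp add: last_run_head_def increasing_runs_snoc)

lemma last_run_rise_snoc:
  "w \<noteq> [] \<Longrightarrow> last_run_rise (w @ [x]) = (if x < last w then 0 else x - last_run_head w)"
  by (simp add: last_run_rise_def last_run_head_snoc)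

lemma last_run_head_le_last: "w \<noteq> [] \<Longrightarrow> last_run_head w \<le> last w"
  by (induction w rule: rev_nonempty_induct)
     (auto simp: last_run_head_singleton last_run_head_snoc)

lemma flattened_snoc:
  assumes "w \<noteq> []"
  shows "flattened (w @ [x]) \<longleftrightarrow> flattened w \<and> last_run_head w \<le> x"
proof -
  obtain rs r where runs: "increasing_runs w = rs @ [r]" and "r \<noteq> []"
    using increasing_runs_nonempty[OF assms] by (metis append_butlast_last_id)
  moreover from this have "last_run_head w = hd r" by (simp add: last_run_head_def)
  ultimately show ?thesis
    using last_run_head_le_last[OF assms] increasing_runs_snoc[OF assms, of x]
    by (auto simp: flattened_def sorted_append)
qed

lemma catalan_word_snoc:
  assumes "w \<noteq> []"
  shows "catalan_word (w @ [x]) \<longleftrightarrow> catalan_word w \<and> 1 \<le> x \<and> x \<le> last w + 1"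
proof -
  obtain m where m: "length w = Suc m" using assms by (cases w) auto
  let ?step = "\<lambda>v i. 1 \<le> v ! (i + 1) \<and> v ! (i + 1) \<le> v ! i + 1"
  have "(\<forall>i. i + 1 < length (w @ [x]) \<longrightarrow> ?step (w @ [x]) i) \<longleftrightarrow>
        (\<forall>i. i + 1 < length w \<longrightarrow> ?step (w @ [x]) i) \<and> ?step (w @ [x]) m"
    using m by (auto simp: less_Suc_eq)
  also have "(\<forall>i. i + 1 < length w \<longrightarrow> ?step (w @ [x]) i) \<longleftrightarrow> (\<forall>i. i + 1 < length w \<longrightarrow> ?step w i)"
    by (auto simp: nth_append)
  also have "?step (w @ [x]) m \<longleftrightarrow> 1 \<le> x \<and> x \<le> last w + 1"
    using assms m by (simp add: nth_append last_conv_nth)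
  finally show ?thesis
    using assms by (auto simp: catalan_word_def nth_append)
qed

lemma catalan_word_singleton: "catalan_word [x] \<longleftrightarrow> x = 1"
  by (auto simp: catalan_word_def)

lemma last_run_head_ge_1:
  assumes "w \<noteq> []" "catalan_word w"
  shows "1 \<le> last_run_head w"
  using assms
  by (induction w rule: rev_nonempty_induct)
     (auto simp: last_run_head_singleton last_run_head_snoc catalan_word_snoc catalan_word_singleton)

lemma length_flattened_catalan_word: "w \<in> flattened_catalan_words n \<Longrightarrow> length w = n"
  by (simp add: flattened_catalan_words_def)

lemma flattened_catalan_words_1: "flattened_catalan_words (Suc 0) = {[1]}"
  by (auto simp: flattened_catalan_words_def length_Suc_conv catalan_word_singleton
        flattened_def increasing_runs_singleton)

text \<open>
  After a descent to \<open>x\<close>, the word stays flattened iff \<open>x\<close> is at least the first letter of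
  the last run. A letter that prolongs the last run is at least the last letter, hence above
  this bound as well. As the first letter of the last run is at least \<open>1\<close>, a single interval
  describes the admissible letters.
\<close>

lemma flattened_catalan_words_Suc:
  assumes "n \<ge> 1"
  shows "flattened_catalan_words (Suc n) =
    (\<lambda>(w, x). w @ [x]) ` (SIGMA w : flattened_catalan_words n. {last_run_head w .. last w + 1})"
    (is "?L = ?R")
proof -
  have snoc: "w @ [x] \<in> ?L \<longleftrightarrow> w \<in> flattened_catalan_words n \<and> x \<in> {last_run_head w .. last w + 1}"
    for w x
  proof (cases "w = []")
    case False
    then show ?thesis
      using last_run_head_ge_1[OF False]
      by (force simp: flattened_catalan_words_def flattened_snoc catalan_word_snoc)
  qed (use assms in \<open>auto simp: flattened_catalan_words_def\<close>)
  show ?thesis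
  proof (intro equalityI subsetI)
    fix v assume v: "v \<in> ?L"
    then have "v \<noteq> []" by (auto simp: flattened_catalan_words_def)
    then have "v = butlast v @ [last v]" by simp
    with v snoc show "v \<in> ?R" by (metis (no_types, lifting) SigmaI case_prod_conv image_eqI)
  qed (use snoc in auto)
qed

lemma finite_flattened_catalan_words: "n \<ge> 1 \<Longrightarrow> finite (flattened_catalan_words n)"
  by (induction n rule: nat_induct_at_least)
     (auto simp: flattened_catalan_words_1 flattened_catalan_words_Suc)

text \<open>The three summands collect the descents, the level and the ascent.\<close>

lemma sum_flattened_catalan_words_Suc:
  fixes h :: "int list \<Rightarrow> real"
  assumes "n \<ge> 1"
  shows "(\<Sum>w \<in> flattened_catalan_words (Suc n). h w) =
    (\<Sum>w \<in> flattened_catalan_words n.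
       (\<Sum>x \<in> {last_run_head w ..< last w}. h (w @ [x])) + h (w @ [last w]) + h (w @ [last w + 1]))"
proof -
  let ?F = "flattened_catalan_words n"
  have split: "{last_run_head w .. last w + 1} =
      insert (last w + 1) (insert (last w) {last_run_head w ..< last w})" if "w \<in> ?F" for w
  proof -
    have "w \<noteq> []" using that assms length_flattened_catalan_word by fastforce
    with last_run_head_le_last show ?thesis by force
  qed
  have "(\<Sum>w \<in> flattened_catalan_words (Suc n). h w) =
        (\<Sum>(w, x) \<in> (SIGMA w : ?F. {last_run_head w .. last w + 1}). h (w @ [x]))"
    unfolding flattened_catalan_words_Suc[OF assms]
    by (subst sum.reindex) (auto simp: inj_on_def case_prod_unfold)
  also have "\<dots> = (\<Sum>w \<in> ?F. \<Sum>x \<in> {last_run_head w .. last w + 1}. h (w @ [x]))"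
    by (rule sum.Sigma[symmetric]) (use assms finite_flattened_catalan_words in auto)
  also have "\<dots> = (\<Sum>w \<in> ?F.
       (\<Sum>x \<in> {last_run_head w ..< last w}. h (w @ [x])) + h (w @ [last w]) + h (w @ [last w + 1]))"
    by (rule sum.cong) (simp_all add: split)
  finally show ?thesis .
qed

section \<open>Linear recurrences\<close>

text \<open>
  Arbitrary weights for ascents, levels and descents treat the three pattern counts at once:
  each of them is the case of one weight \<open>1\<close> and two weights \<open>0\<close>.
\<close>

definition step_weight :: "real \<Rightarrow> real \<Rightarrow> real \<Rightarrow> int \<Rightarrow> int \<Rightarrow> real" where
  "step_weight \<alpha> \<beta> \<gamma> a b = (if a < b then \<alpha> else if a = b then \<beta> else \<gamma>)"

definition total_weight :: "real \<Rightarrow> real \<Rightarrow> real \<Rightarrow> int list \<Rightarrow> real" where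
  "total_weight \<alpha> \<beta> \<gamma> w = (\<Sum>i < length w - 1. step_weight \<alpha> \<beta> \<gamma> (w ! i) (w ! (i + 1)))"

lemma total_weight_snoc:
  assumes "w \<noteq> []"
  shows "total_weight \<alpha> \<beta> \<gamma> (w @ [x]) = total_weight \<alpha> \<beta> \<gamma> w + step_weight \<alpha> \<beta> \<gamma> (last w) x"
proof -
  obtain m where m: "length w = Suc m" using assms by (cases w) auto
  then have "last w = w ! m" using assms by (simp add: last_conv_nth)
  with m show ?thesis by (simp add: total_weight_def nth_append)
qed

abbreviation rise_sum :: "nat \<Rightarrow> real" where
  "rise_sum n \<equiv> \<Sum>w \<in> flattened_catalan_words n. of_int (last_run_rise w)"

text \<open>
  The number of descents out of a word \<open>w\<close> is the rise \<open>d w\<close> of its last run. Hence the sum of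
  \<open>s\<close> over the next length involves the sum of \<open>s d\<close>. No sum of \<open>d\<^sup>2\<close> appears in turn, because
  a descent resets the rise to \<open>0\<close>; this makes the system closed.
\<close>

lemma flattened_catalan_words_recurrences:
  fixes \<alpha> \<beta> \<gamma> :: real and n :: nat
  defines "A \<equiv> \<lambda>n. real (card (flattened_catalan_words n))"
    and "X \<equiv> \<lambda>n. \<Sum>w \<in> flattened_catalan_words n. total_weight \<alpha> \<beta> \<gamma> w"
    and "Y \<equiv> \<lambda>n. \<Sum>w \<in> flattened_catalan_words n. total_weight \<alpha> \<beta> \<gamma> w * of_int (last_run_rise w)"
  assumes "n \<ge> 1"
  shows "A (Suc n) = 2 * A n + rise_sum n"
    and "rise_sum (Suc n) = A n + 2 * rise_sum n"
    and "X (Suc n) = 2 * X n + Y n + (\<alpha> + \<beta>) * A n + \<gamma> * rise_sum n"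
    and "Y (Suc n) = X n + 2 * Y n + \<alpha> * (A n + rise_sum n) + \<beta> * rise_sum n"
proof -
  let ?F = "flattened_catalan_words n" and ?s = "total_weight \<alpha> \<beta> \<gamma>" and ?d = last_run_rise
  have w: "w \<noteq> []" "last_run_head w \<le> last w"
    "of_int (?d w) = (of_int (last w) - of_int (last_run_head w) :: real)" if "w \<in> ?F" for w
  proof -
    show "w \<noteq> []" using that assms(4) length_flattened_catalan_word by fastforce
    from last_run_head_le_last[OF this] show "last_run_head w \<le> last w"
      "of_int (?d w) = (of_int (last w) - of_int (last_run_head w) :: real)"
      by (auto simp: last_run_rise_def)
  qed
  note sum_Suc = sum_flattened_catalan_words_Suc[OF assms(4)]
  have A_sum: "A k = (\<Sum>w \<in> flattened_catalan_words k. 1)" for k by (simp add: A_def)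
  have "A (Suc n) = (\<Sum>w \<in> ?F. 2 * 1 + of_int (?d w))"
    unfolding A_sum sum_Suc by (rule sum.cong) (auto simp: w)
  then show "A (Suc n) = 2 * A n + rise_sum n"
    by (simp add: A_sum sum.distrib sum_distrib_left)
  have "rise_sum (Suc n) = (\<Sum>w \<in> ?F. 1 + 2 * of_int (?d w))"
    unfolding sum_Suc by (rule sum.cong) (auto simp: w last_run_rise_snoc)
  then show "rise_sum (Suc n) = A n + 2 * rise_sum n"
    by (simp add: A_sum sum.distrib sum_distrib_left)
  have "X (Suc n) = (\<Sum>w \<in> ?F. 2 * ?s w + ?s w * of_int (?d w) + (\<alpha> + \<beta>) * 1 + \<gamma> * of_int (?d w))"
    unfolding X_def sum_Suc
    by (rule sum.cong) (auto simp: w total_weight_snoc step_weight_def algebra_simps)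
  then show "X (Suc n) = 2 * X n + Y n + (\<alpha> + \<beta>) * A n + \<gamma> * rise_sum n"
    unfolding X_def Y_def A_sum by (simp only: sum.distrib sum_distrib_left)
  have "Y (Suc n) = (\<Sum>w \<in> ?F. ?s w + 2 * (?s w * of_int (?d w)) + \<alpha> * (1 + of_int (?d w)) + \<beta> * of_int (?d w))"
    unfolding Y_def sum_Suc
    by (rule sum.cong)
       (auto simp: w total_weight_snoc last_run_rise_snoc step_weight_def algebra_simps)
  then show "Y (Suc n) = X n + 2 * Y n + \<alpha> * (A n + rise_sum n) + \<beta> * rise_sum n"
    unfolding X_def Y_def A_sum by (simp only: sum.distrib flip: sum_distrib_left)
qed

text \<open>
  With \<open>p = 3 ^ m\<close>, inserting \<open>A = (p + 1) / 2\<close> and \<open>(p - 1) / 2\<close> for the sum of the rises gives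
  \<open>U' = 3 U + \<alpha> (3 p + 1) / 2 + \<beta> p + \<gamma> (p - 1) / 2\<close> for \<open>U = X + Y\<close> and
  \<open>V' = V + (\<gamma> - \<alpha>) (p - 1) / 2 + \<beta>\<close> for \<open>V = X - Y\<close>. The terms proportional to \<open>p\<close> resonate
  with the factor \<open>3\<close> in the first recurrence, which is where \<open>m * 3 ^ m\<close> comes from.
\<close>

lemma flattened_catalan_words_closed_forms:
  fixes \<alpha> \<beta> \<gamma> :: real and m :: nat
  defines "A \<equiv> real (card (flattened_catalan_words (Suc m)))"
    and "X \<equiv> \<Sum>w \<in> flattened_catalan_words (Suc m). total_weight \<alpha> \<beta> \<gamma> w"
    and "Y \<equiv> \<Sum>w \<in> flattened_catalan_words (Suc m). total_weight \<alpha> \<beta> \<gamma> w * of_int (last_run_rise w)"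
  shows "A = (3 ^ m + 1) / 2"
    and "rise_sum (Suc m) = (3 ^ m - 1) / 2"
    and "X + Y = \<alpha> * (real m * 3 ^ m / 2 + (3 ^ m - 1) / 4) + \<beta> * (real m * 3 ^ m / 3)
                 + \<gamma> * (real m * 3 ^ m / 6 - (3 ^ m - 1) / 4)"
    and "X - Y = (\<gamma> - \<alpha>) * ((3 ^ m - 1) / 4 - m / 2) + \<beta> * m"
proof -
  have "A = (3 ^ m + 1) / 2 \<and> rise_sum (Suc m) = (3 ^ m - 1) / 2 \<and>
    X + Y = \<alpha> * (real m * 3 ^ m / 2 + (3 ^ m - 1) / 4) + \<beta> * (real m * 3 ^ m / 3)
            + \<gamma> * (real m * 3 ^ m / 6 - (3 ^ m - 1) / 4) \<and>
    X - Y = (\<gamma> - \<alpha>) * ((3 ^ m - 1) / 4 - m / 2) + \<beta> * m"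
    unfolding A_def X_def Y_def
  proof (induction m)
    case 0
    show ?case
      by (simp add: flattened_catalan_words_1 last_run_rise_def last_run_head_singleton total_weight_def)
  next
    case (Suc m)
    define p :: real where "p = 3 ^ m"
    let ?X = "\<lambda>n. \<Sum>w \<in> flattened_catalan_words n. total_weight \<alpha> \<beta> \<gamma> w"
    let ?Y = "\<lambda>n. \<Sum>w \<in> flattened_catalan_words n. total_weight \<alpha> \<beta> \<gamma> w * of_int (last_run_rise w)"
    note rec = flattened_catalan_words_recurrences[of "Suc m", simplified]
    have A: "real (card (flattened_catalan_words (Suc m))) = (p + 1) / 2"
      and T: "rise_sum (Suc m) = (p - 1) / 2"
      and U: "?X (Suc m) + ?Y (Suc m) = \<alpha> * (real m * p / 2 + (p - 1) / 4) + \<beta> * (real m * p / 3)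
            + \<gamma> * (real m * p / 6 - (p - 1) / 4)"
      and V: "?X (Suc m) - ?Y (Suc m) = (\<gamma> - \<alpha>) * ((p - 1) / 4 - m / 2) + \<beta> * m"
      using Suc.IH by (simp_all only: p_def)
    have "?X (Suc (Suc m)) + ?Y (Suc (Suc m)) =
        3 * (?X (Suc m) + ?Y (Suc m)) + \<alpha> * (3 * p + 1) / 2 + \<beta> * p + \<gamma> * (p - 1) / 2"
      unfolding rec A T by (simp add: field_simps)
    moreover have "?X (Suc (Suc m)) - ?Y (Suc (Suc m)) =
        (?X (Suc m) - ?Y (Suc m)) + (\<gamma> - \<alpha>) * (p - 1) / 2 + \<beta>"
      unfolding rec A T by (simp add: field_simps)
    ultimately show ?case
      unfolding U V unfolding rec(1,2) A T
      by (simp add: p_def[symmetric] field_simps)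
  qed
  then show "A = (3 ^ m + 1) / 2" "rise_sum (Suc m) = (3 ^ m - 1) / 2"
    "X + Y = \<alpha> * (real m * 3 ^ m / 2 + (3 ^ m - 1) / 4) + \<beta> * (real m * 3 ^ m / 3)
             + \<gamma> * (real m * 3 ^ m / 6 - (3 ^ m - 1) / 4)"
    "X - Y = (\<gamma> - \<alpha>) * ((3 ^ m - 1) / 4 - m / 2) + \<beta> * m"
    by auto
qed

section \<open>Pattern counts and the last run\<close>

lemma order_isomorphic_pair:
  "order_isomorphic [c, d] [a, b] \<longleftrightarrow> (c < d \<longleftrightarrow> a < b) \<and> (d < c \<longleftrightarrow> b < a)"
  by (auto simp: order_isomorphic_def less_Suc_eq)

lemma factor_pair:
  assumes "Suc (Suc i) \<le> length w"
  shows "factor i (Suc (Suc i)) w = [w ! i, w ! Suc i]"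
  using assms by (intro nth_equalityI) (auto simp: factor_def less_2_cases_iff)

text \<open>
  Two adjacent letters are order-isomorphic to \<open>ab\<close> iff they form the same kind of step as
  \<open>ab\<close>, so that counting occurrences means giving weight \<open>1\<close> to this kind only.
\<close>

lemma tot_pair_eq_sum:
  assumes "n \<ge> 1"
  shows "real (tot n [a, b]) = (\<Sum>w \<in> flattened_catalan_words n.
           total_weight (of_bool (a < b)) (of_bool (a = b)) (of_bool (b < a)) w)"
proof -
  let ?I = "\<lambda>w. {i. i + 2 \<le> n \<and> order_isomorphic (factor i (i + 2) w) [a, b]}"
  have "{(w, i). w \<in> flattened_catalan_words n \<and> i + length [a, b] \<le> n \<and>
      order_isomorphic (factor i (i + length [a, b]) w) [a, b]} = (SIGMA w : flattened_catalan_words n. ?I w)"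
    by (auto simp: numeral_2_eq_2)
  moreover have "finite (?I w)" for w by (rule finite_subset[of _ "{..n}"]) auto
  ultimately have "real (tot n [a, b]) = (\<Sum>w \<in> flattened_catalan_words n. real (card (?I w)))"
    unfolding tot_def
    by (simp add: finite_flattened_catalan_words[OF assms])
  also have "\<dots> = (\<Sum>w \<in> flattened_catalan_words n.
           total_weight (of_bool (a < b)) (of_bool (a = b)) (of_bool (b < a)) w)"
  proof (rule sum.cong)
    fix w assume "w \<in> flattened_catalan_words n"
    then have len: "length w = n" by (rule length_flattened_catalan_word)
    let ?P = "\<lambda>i. (w ! i < w ! (i + 1) \<longleftrightarrow> a < b) \<and> (w ! (i + 1) < w ! i \<longleftrightarrow> b < a)"
    have "?I w = {i \<in> {..<n - 1}. ?P i}"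
      by (auto simp: factor_pair len order_isomorphic_pair)
    then have "real (card (?I w)) = (\<Sum>i < n - 1. of_bool (?P i))"
      by (simp add: Int_def)
    also have "\<dots> = total_weight (of_bool (a < b)) (of_bool (a = b)) (of_bool (b < a)) w"
      unfolding total_weight_def len
      by (rule sum.cong) (auto simp: step_weight_def)
    finally show "real (card (?I w)) =
      total_weight (of_bool (a < b)) (of_bool (a = b)) (of_bool (b < a)) w" .
  qed simp
  finally show ?thesis .
qed

text \<open>Letters increase by at most one along a Catalan word, so a run skips no value.\<close>

lemma set_last_run_catalan_word:
  assumes "w \<noteq> []" "catalan_word w"
  shows "set (last (increasing_runs w)) = {last_run_head w .. last w}"
  using assms
proof (induction w rule: rev_nonempty_induct)
  case (single x)
  then show ?case by (simp add: increasing_runs_singleton last_run_head_singleton)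
next
  case (snoc x w)
  then have "x \<le> last w + 1" "set (last (increasing_runs w)) = {last_run_head w .. last w}"
    by (auto simp: catalan_word_snoc)
  with snoc.hyps last_run_head_le_last[OF snoc.hyps] show ?case
    by (auto simp: increasing_runs_snoc last_run_head_snoc)
qed

lemma trun_eq_rise:
  assumes "w \<noteq> []" "catalan_word w"
  shows "real (trun w) - 1 = of_int (last_run_rise w)"
  using last_run_head_le_last[OF assms(1)]
  by (simp add: trun_def set_last_run_catalan_word[OF assms] last_run_rise_def)

theorem corollary2p1:
  fixes n :: nat
  assumes "n \<ge> 1"
  shows "real (tot n [1, 2]) = (real n - 1) * (3 powi (int n - 1) + 1) / 4 \<and>
         real (tot n [2, 1]) = (real n - 1) * (3 powi (int n - 2) - 1) / 4 \<and>
         real (tot n [1, 1]) = (real n - 1) * (3 powi (int n - 2) + 1) / 2 \<and>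
         (\<Sum>\<pi>\<in>flattened_catalan_words n. real (trun \<pi>) - 1) = (3 powi (int n - 1) - 1) / 2"
proof -
  obtain m where m: "n = Suc m" using assms by (cases n) auto
  have powers: "(3::real) powi (int n - 1) = 3 ^ m" "(3::real) powi (int n - 2) = 3 ^ m / 3"
  proof -
    show "(3::real) powi (int n - 1) = 3 ^ m" by (simp add: m)
    have "(3::real) powi (int m - 1) = 3 powi int m / 3 powi 1"
      by (rule power_int_diff) simp
    then show "(3::real) powi (int n - 2) = 3 ^ m / 3" by (simp add: m)
  qed
  have X: "(\<Sum>w \<in> flattened_catalan_words n. total_weight \<alpha> \<beta> \<gamma> w) =
      m * (\<alpha> * (3 ^ m + 1) / 4 + \<beta> * (3 ^ m / 3 + 1) / 2 + \<gamma> * (3 ^ m / 3 - 1) / 4)" for \<alpha> \<beta> \<gamma> :: real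
    using flattened_catalan_words_closed_forms(3,4)[of \<alpha> \<beta> \<gamma> m] unfolding m
    by (simp add: field_simps)
  have "(\<Sum>\<pi>\<in>flattened_catalan_words n. real (trun \<pi>) - 1) = rise_sum n"
    by (rule sum.cong) (auto simp: trun_eq_rise flattened_catalan_words_def catalan_word_def)
  also have "\<dots> = (3 ^ m - 1) / 2"
    unfolding m by (rule flattened_catalan_words_closed_forms)
  finally show ?thesis
    by (simp add: tot_pair_eq_sum[OF assms] X powers) (simp add: m)
qed

end
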